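(* Assume $K(x,y)>0$, $\mu(x)>0$, $\nu(y)>0$ for all $x,y\in S$. For every $g_0\in\mathcal H$, the initial value problem $$\dot g_t=-\log\frac{m_{g_t}}{\nu}+\mathbb E_\nu\!\left[\log\frac{m_{g_t}}{\nu}\right]\mathbf 1,\qquad g_{t=0}=g_0,$$ admits a unique global solution $g_t\in\mathcal H$, $t\ge 0$. Moreover, for all $t\ge0$, $$\frac{d}{dt}\mathcal J(g_t)=-\operatorname{KL}(m_{g_t}\,\|\,\nu)-\operatorname{KL}(\nu\,\|\,m_{g_t})\le 0.$$ There exists a unique $g^\star\in\mathcal H$ such that $m_{g^\star}=\nu$. Moreover, $g_t\to g^\star$ and $m_{g_t}\to\nu$ as $t\to\infty$.
   Context: Let $N\ge1$ be an integer and $S=\{1,\dots,N\}$. Let $Q\in\mathbb R^{N\times N}$ be the generator of a continuous-time Markov chain on $S$ (nonnegative off-diagonal entries, rows summing to zero) and $K=e^{Q}$. Let $\mu,\nu$ be probability distributions on $S$. Functions $g:S\to\mathbb R$ are identified with vectors in $\mathbb R^S$; $\mathbf 1$ is the constant function $1$; $\mathbb E_\nu[f]=\sum_{y\in S}\nu(y)f(y)$; $\log\frac{m}{\nu}$ is the function $y\mapsto\log(m(y)/\nu(y))$; $\operatorname{KL}(p\|q)=\sum_y p(y)\log\frac{p(y)}{q(y)}$. For $g\in\mathbb R^S$ set $Z_g(x)=\sum_{z\in S}K(x,z)e^{g(z)}$, $p_g(y|x)=\frac{K(x,y)e^{g(y)}}{Z_g(x)}$, $m_g(y)=\sum_{x\in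 S}\mu(x)p_g(y|x)$ (a strictly positive probability distribution on $S$), and $$\mathcal J(g)=\sum_{x\in S}\mu(x)\log Z_g(x)-\mathbb E_\nu[g].$$ The gauge-fixed space is $\mathcal H=\{g\in\mathbb R^S:\mathbb E_\nu[g]=0\}$. *)

theory Defs
  imports "HOL-Analysis.Analysis"
begin

text \<open>
  The state space \<open>{1, \<dots>, N}\<close> is a finite type \<open>'n\<close> with \<open>N = CARD('n)\<close>. Functions on it are
  vectors \<open>real ^ 'n\<close>; here \<open>1 :: real ^ 'n\<close> is the constant function 1.
\<close>

definition generator :: "real ^ 'n ^ 'n \<Rightarrow> bool" where
  "generator Q \<longleftrightarrow> (\<forall>x y. x \<noteq> y \<longrightarrow> 0 \<le> Q $ x $ y) \<and> (\<forall>x. (\<Sum>y\<in>UNIV. Q $ x $ y) = 0)"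

definition prob_vec :: "real ^ 'n \<Rightarrow> bool" where
  "prob_vec p \<longleftrightarrow> (\<forall>x. 0 \<le> p $ x) \<and> (\<Sum>x\<in>UNIV. p $ x) = 1"

text \<open>
  Multiplication and power of the type class on \<open>real ^ 'n ^ 'n\<close> are componentwise, so powers of
  a matrix are written as iterated products \<open>**\<close>.
\<close>

definition mat_exp :: "real ^ 'n ^ 'n \<Rightarrow> real ^ 'n ^ 'n" where
  "mat_exp A = (\<Sum>k. (1 / fact k) *\<^sub>R (((**) A) ^^ k) (mat 1))"

lemma mat_exp_sums:
  fixes A :: "real ^ 'n ^ 'n"
  shows "(\<lambda>k. (1 / fact k) *\<^sub>R (((**) A) ^^ k) (mat 1)) sums mat_exp A"
proof -
  define c where "c = (\<Sum>i\<in>UNIV. \<Sum>j\<in>UNIV. \<bar>A $ i $ j\<bar>)"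
  have row: "(\<Sum>l\<in>UNIV. \<bar>A $ i $ l\<bar>) \<le> c" for i
    unfolding c_def
    by (rule member_le_sum[of i UNIV "\<lambda>i. \<Sum>l\<in>UNIV. \<bar>A $ i $ l\<bar>"]) (auto intro: sum_nonneg)
  have c0: "0 \<le> c"
    unfolding c_def by (intro sum_nonneg) auto
  have bound: "\<bar>(((**) A) ^^ k) (mat 1) $ i $ j\<bar> \<le> c ^ k" for k i j
  proof (induction k arbitrary: i)
    case 0
    show ?case by (simp add: mat_def)
  next
    case (Suc k)
    have "\<bar>(((**) A) ^^ Suc k) (mat 1) $ i $ j\<bar>
        = \<bar>\<Sum>l\<in>UNIV. A $ i $ l * (((**) A) ^^ k) (mat 1) $ l $ j\<bar>"
      by (simp add: matrix_matrix_mult_def)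
    also have "\<dots> \<le> (\<Sum>l\<in>UNIV. \<bar>A $ i $ l\<bar> * c ^ k)"
      by (rule order_trans[OF sum_abs], rule sum_mono)
         (auto simp: abs_mult intro: mult_left_mono Suc.IH)
    also have "\<dots> \<le> c * c ^ k"
      unfolding sum_distrib_right[symmetric]
      by (intro mult_right_mono row zero_le_power c0)
    finally show ?case by simp
  qed
  have "summable (\<lambda>k. (1 / fact k) *\<^sub>R (((**) A) ^^ k) (mat 1) :: real ^ 'n ^ 'n)"
  proof (rule summable_comparison_test')
    have "summable (\<lambda>k. c ^ k /\<^sub>R fact k)"
      by (rule summable_exp_generic)
    then show "summable (\<lambda>k. real CARD('n) * real CARD('n) * (c ^ k /\<^sub>R fact k))"
      by (rule summable_mult)
  next
    fix k :: nat
    let ?P = "(((**) A) ^^ k) (mat 1)"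
    have "norm ?P \<le> (\<Sum>i\<in>UNIV. norm (?P $ i))"
      unfolding norm_vec_def[of ?P] by (rule L2_set_le_sum) simp
    also have "\<dots> \<le> (\<Sum>i\<in>(UNIV::'n set). \<Sum>j\<in>(UNIV::'n set). c ^ k)"
      by (intro sum_mono order_trans[OF norm_le_l1_cart] bound)
    finally have "norm ?P \<le> real CARD('n) * real CARD('n) * c ^ k"
      by simp
    then have "norm ?P / fact k \<le> real CARD('n) * real CARD('n) * c ^ k / fact k"
      by (rule divide_right_mono) simp
    then show "norm ((1 / fact k) *\<^sub>R ?P) \<le> real CARD('n) * real CARD('n) * (c ^ k /\<^sub>R fact k)"
      by (simp add: field_simps)
  qed
  then show ?thesis
    unfolding mat_exp_def by (rule summable_sums)
qed

definition expect :: "real ^ 'n \<Rightarrow> real ^ 'n \<Rightarrow> real" where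
  "expect p f = (\<Sum>y\<in>UNIV. p $ y * f $ y)"

definition log_ratio :: "real ^ 'n \<Rightarrow> real ^ 'n \<Rightarrow> real ^ 'n" where
  "log_ratio p q = (\<chi> y. ln (p $ y / q $ y))"

definition KL :: "real ^ 'n \<Rightarrow> real ^ 'n \<Rightarrow> real" where
  "KL p q = (\<Sum>y\<in>UNIV. p $ y * ln (p $ y / q $ y))"

definition partition_fun :: "real ^ 'n ^ 'n \<Rightarrow> real ^ 'n \<Rightarrow> 'n \<Rightarrow> real" where
  "partition_fun K g x = (\<Sum>z\<in>UNIV. K $ x $ z * exp (g $ z))"

definition tilted_kernel :: "real ^ 'n ^ 'n \<Rightarrow> real ^ 'n \<Rightarrow> 'n \<Rightarrow> 'n \<Rightarrow> real" where
  "tilted_kernel K g x y = K $ x $ y * exp (g $ y) / partition_fun K g x"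

definition model_marginal :: "real ^ 'n ^ 'n \<Rightarrow> real ^ 'n \<Rightarrow> real ^ 'n \<Rightarrow> real ^ 'n" where
  "model_marginal K \<mu> g = (\<chi> y. \<Sum>x\<in>UNIV. \<mu> $ x * tilted_kernel K g x y)"

definition dual_objective :: "real ^ 'n ^ 'n \<Rightarrow> real ^ 'n \<Rightarrow> real ^ 'n \<Rightarrow> real ^ 'n \<Rightarrow> real" where
  "dual_objective K \<mu> \<nu> g = (\<Sum>x\<in>UNIV. \<mu> $ x * ln (partition_fun K g x)) - expect \<nu> g"

definition gauge_space :: "real ^ 'n \<Rightarrow> (real ^ 'n) set" where
  "gauge_space \<nu> = {g. expect \<nu> g = 0}"

definition flow_field :: "real ^ 'n ^ 'n \<Rightarrow> real ^ 'n \<Rightarrow> real ^ 'n \<Rightarrow> real ^ 'n \<Rightarrow> real ^ 'n" where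
  "flow_field K \<mu> \<nu> g =
     - log_ratio (model_marginal K \<mu> g) \<nu>
     + expect \<nu> (log_ratio (model_marginal K \<mu> g) \<nu>) *\<^sub>R 1"

text \<open>
  Solutions live on \<open>[0, \<infinity>)\<close>: the derivative at 0 is one-sided and the values of \<open>g\<close> at negative
  times are irrelevant.
\<close>

definition global_solution ::
    "('a::real_normed_vector \<Rightarrow> 'a) \<Rightarrow> 'a \<Rightarrow> (real \<Rightarrow> 'a) \<Rightarrow> bool" where
  "global_solution F g0 g \<longleftrightarrow>
     g 0 = g0 \<and> (\<forall>t\<ge>0. (g has_vector_derivative F (g t)) (at t within {0..}))"

end

theory Submission
  imports Defs
begin

text \<open>
  The flow is a continuous-time Sinkhorn iteration, and everything rests on one contraction
  estimate. Since \<open>m\<^sub>g(y) = e\<^bsup>g(y)\<^esup> \<Sum>\<^sub>x \<mu>(x) K(x,y) / Z\<^sub>g(x)\<close>, the term \<open>g\<close> cancels in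
  \<open>g + F g\<close>, where \<open>F\<close> is the vector field of the flow: up to an additive constant, \<open>g + F g\<close> is
  \<open>log \<nu>\<close> minus the composition, with a change of sign in between, of two log-partition maps, one
  for the kernel \<open>K\<close> and one for its \<open>\<mu>\<close>-weighted transpose. Constants are invisible to the oscillation seminorm
  \<open>osc w = max w - min w\<close>, and the log-partition map of a strictly positive matrix is a strict
  contraction for it (\<open>log_partition_contraction\<close>). Hence \<open>g \<mapsto> g + F g\<close> contracts \<open>osc\<close> by some
  factor \<open>\<kappa> < 1\<close> (\<open>sinkhorn_step_contraction\<close>). On functions of \<open>\<nu>\<close>-mean zero, \<open>osc\<close> is
  equivalent to the norm (\<open>norm_le_osc\<close>), and \<open>F\<close> takes values in this space.

  The consequences are as follows.
  \<^item> \<open>F\<close> is globally Lipschitz, so global solutions exist by the Picard-Lindeloef theorem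
    (\<open>lipschitz_field_global_solution\<close>). They stay in the gauge space because \<open>F\<close> has mean zero.
  \<^item> The difference \<open>w\<close> of two solutions satisfies \<open>w' = - w + r\<close> with \<open>osc r \<le> \<kappa> osc w\<close>, so
    Gronwall's inequality gives \<open>osc (w t) \<le> e\<^bsup>-(1-\<kappa>)t\<^esup> osc (w 0)\<close> (\<open>solutions_contract\<close>). Equal
    initial values give uniqueness; comparison with a stationary solution gives exponential
    convergence.
  \<^item> The zeros of \<open>F\<close> are exactly the \<open>g\<close> with \<open>m\<^sub>g = \<nu>\<close>. Iterating \<open>g \<mapsto> g + F g\<close> from 0 produces one,
    and two of them in the gauge space coincide by contraction.

  The dissipation identity is the chain rule: the gradient of \<open>\<J>\<close> is \<open>m\<^sub>g - \<nu>\<close>, which sums to zero,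
  so pairing it with \<open>F g\<close> leaves \<open>- \<Sum>\<^sub>y (m\<^sub>g(y) - \<nu>(y)) log (m\<^sub>g(y) / \<nu>(y))\<close>. This is minus
  the sum of the two divergences, and each of its terms has a sign.
\<close>

section \<open>Differential inequalities on the half-line\<close>

lemma halfline_nonincreasing:
  fixes f f' :: "real \<Rightarrow> real"
  assumes der: "\<And>t. t \<ge> 0 \<Longrightarrow> (f has_real_derivative f' t) (at t within {0..})"
    and nonpos: "\<And>t. t \<ge> 0 \<Longrightarrow> f' t \<le> 0"
    and "t \<ge> 0"
  shows "f t \<le> f 0"
proof (rule DERIV_nonpos_imp_decreasing_open[OF \<open>t \<ge> 0\<close>])
  fix x assume "0 < x" "x < t"
  then have "at x within {0..} = at x"
    by (intro at_within_interior) (simp add: interior_real_atLeast)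
  then show "\<exists>y. (f has_real_derivative y) (at x) \<and> y \<le> 0"
    using der[of x] nonpos[of x] \<open>0 < x\<close> by auto
next
  have "continuous_on {0..} f"
    by (auto simp: continuous_on_eq_continuous_within intro: DERIV_continuous der)
  then show "continuous_on {0..t} f"
    by (rule continuous_on_subset) auto
qed

lemma halfline_constant:
  fixes f :: "real \<Rightarrow> real"
  assumes der: "\<And>t. t \<ge> 0 \<Longrightarrow> (f has_real_derivative 0) (at t within {0..})" and "t \<ge> 0"
  shows "f t = f 0"
proof (rule antisym)
  show "f t \<le> f 0"
    using halfline_nonincreasing[of f "\<lambda>_. 0" t] assms by auto
  have "((\<lambda>t. - f t) has_real_derivative 0) (at t within {0..})" if "t \<ge> 0" for t
    using DERIV_minus[OF der[OF that]] by simp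
  then have "- f t \<le> - f 0"
    using halfline_nonincreasing[of "\<lambda>t. - f t" "\<lambda>_. 0" t] \<open>t \<ge> 0\<close> by auto
  then show "f 0 \<le> f t" by simp
qed

section \<open>Global solutions for Lipschitz vector fields\<close>

lemma integral_derivative_halfline:
  fixes f :: "real \<Rightarrow> 'a::banach"
  assumes cont: "continuous_on {0..} f" and "t \<ge> 0"
  shows "((\<lambda>u. integral {0..u} f) has_vector_derivative f t) (at t within {0..})"
proof -
  have "continuous_on {0..t + 1} f"
    by (rule continuous_on_subset[OF cont]) auto
  then have "((\<lambda>u. integral {0..u} f) has_vector_derivative f t) (at t within {0..t + 1})"
    by (rule integral_has_vector_derivative) (use \<open>t \<ge> 0\<close> in auto)
  moreover have "at t within {0..} = at t within {0..t + 1}"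
    by (rule at_within_nhd[of t "{t - 1<..<t + 1}"]) auto
  ultimately show ?thesis by simp
qed

lemma norm_integral_le_exp:
  fixes f :: "real \<Rightarrow> 'a::banach"
  assumes "a > 0" "c \<ge> 0" "t \<ge> 0" and cont: "continuous_on {0..t} f"
    and bound: "\<And>s. s \<in> {0..t} \<Longrightarrow> norm (f s) \<le> c * exp (a * s)"
  shows "norm (integral {0..t} f) \<le> c / a * exp (a * t)"
proof -
  have "((\<lambda>s. c * exp (a * s)) has_integral (c / a * exp (a * t) - c / a * exp (a * 0))) {0..t}"
    by (rule fundamental_theorem_of_calculus[OF \<open>t \<ge> 0\<close>])
       (use \<open>a > 0\<close> in \<open>auto intro!: derivative_eq_intros
          simp: has_real_derivative_iff_has_vector_derivative[symmetric]\<close>)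
  then have int: "(\<lambda>s. c * exp (a * s)) integrable_on {0..t}"
    and val: "integral {0..t} (\<lambda>s. c * exp (a * s)) = c / a * exp (a * t) - c / a"
    by (auto simp: has_integral_iff)
  have "norm (integral {0..t} f) \<le> integral {0..t} (\<lambda>s. c * exp (a * s))"
    by (rule Henstock_Kurzweil_Integration.integral_norm_bound_integral
          [OF integrable_continuous_real[OF cont] int bound])
  moreover have "c / a \<ge> 0"
    using assms by simp
  ultimately show ?thesis
    using val by linarith
qed

text \<open>
  The Picard operator is made a contraction on the whole half-line at once, without gluing local
  solutions, by Bielecki's weighted norm: writing a solution as \<open>g t = e\<^bsup>2Lt\<^esup> \<phi> t\<close> with \<open>\<phi>\<close> bounded,
  integration of the weight gains a factor \<open>1 / (2 L)\<close> against the Lipschitz constant \<open>L\<close>.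
\<close>

lemma lipschitz_field_global_solution:
  fixes F :: "'a::banach \<Rightarrow> 'a"
  assumes "L > 0" and lip: "\<And>x y. norm (F x - F y) \<le> L * norm (x - y)"
  shows "\<exists>g. global_solution F x0 g"
proof -
  define a where "a = 2 * L"
  have "a > 0" using \<open>L > 0\<close> by (simp add: a_def)
  have contF: "continuous_on UNIV F"
    by (rule lipschitz_on_continuous_on[of L])
       (use lip \<open>L > 0\<close> in \<open>auto intro!: lipschitz_onI simp: dist_norm\<close>)
  define G :: "(real \<Rightarrow>\<^sub>C 'a) \<Rightarrow> real \<Rightarrow> 'a" where "G \<phi> s = F (exp (a * s) *\<^sub>R \<phi> s)" for \<phi> s
  have contG: "continuous_on S (G \<phi>)" for \<phi> S
    unfolding G_def
    by (rule continuous_on_compose2[OF contF]) (auto intro!: continuous_intros)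
  \<comment> \<open>Bounded continuous functions are defined on the whole line, so \<open>P \<phi>\<close> is extended to negative
    times by its value at 0.\<close>
  define P where
    "P \<phi> t = exp (- (a * max 0 t)) *\<^sub>R (x0 + integral {0..max 0 t} (G \<phi>))" for \<phi> t
  have contP: "continuous_on UNIV (P \<phi>)" for \<phi>
  proof -
    have "continuous_on {0..} (\<lambda>u. integral {0..u} (G \<phi>))"
      using integral_derivative_halfline[OF contG[of "{0..}" \<phi>]]
      by (auto simp: continuous_on_eq_continuous_within intro: has_vector_derivative_continuous)
    then have "continuous_on UNIV (\<lambda>t. integral {0..max 0 t} (G \<phi>))"
      by (rule continuous_on_compose2) (auto intro!: continuous_intros)
    then show ?thesis
      unfolding P_def by (intro continuous_intros)
  qed
  have boundP: "norm (P \<phi> t) \<le> norm x0 + (norm (F 0) + L * norm \<phi>) / a" for \<phi> t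
  proof -
    define \<tau> where "\<tau> = max 0 t"
    have "\<tau> \<ge> 0" by (simp add: \<tau>_def)
    have "norm (integral {0..\<tau>} (G \<phi>)) \<le> (norm (F 0) + L * norm \<phi>) / a * exp (a * \<tau>)"
    proof (rule norm_integral_le_exp[OF \<open>a > 0\<close> _ \<open>\<tau> \<ge> 0\<close> contG])
      show "0 \<le> norm (F 0) + L * norm \<phi>"
        using \<open>L > 0\<close> by simp
      fix s assume "s \<in> {0..\<tau>}"
      then have "1 \<le> exp (a * s)" using \<open>a > 0\<close> by simp
      have "norm (G \<phi> s) \<le> norm (F 0) + norm (F (exp (a * s) *\<^sub>R \<phi> s) - F 0)"
        unfolding G_def by (metis norm_triangle_sub)
      also have "\<dots> \<le> norm (F 0) + L * (exp (a * s) * norm (\<phi> s))"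
        using lip[of "exp (a * s) *\<^sub>R \<phi> s" 0] by simp
      also have "\<dots> \<le> norm (F 0) * exp (a * s) + L * (exp (a * s) * norm \<phi>)"
        using \<open>1 \<le> exp (a * s)\<close> \<open>L > 0\<close> norm_bounded[of \<phi> s]
        by (intro add_mono mult_left_mono) (auto intro: mult_left_mono[of 1 "exp (a * s)" "norm (F 0)", simplified])
      finally show "norm (G \<phi> s) \<le> (norm (F 0) + L * norm \<phi>) * exp (a * s)"
        by (simp add: algebra_simps)
    qed
    then have "norm (x0 + integral {0..\<tau>} (G \<phi>))
        \<le> norm x0 + (norm (F 0) + L * norm \<phi>) / a * exp (a * \<tau>)"
      by (rule norm_triangle_le[OF add_left_mono])
    then have "norm (P \<phi> t)
        \<le> exp (- (a * \<tau>)) * (norm x0 + (norm (F 0) + L * norm \<phi>) / a * exp (a * \<tau>))"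
      unfolding P_def \<tau>_def[symmetric] by simp
    also have "\<dots> = exp (- (a * \<tau>)) * norm x0 + (norm (F 0) + L * norm \<phi>) / a"
      by (simp add: exp_minus field_simps)
    also have "\<dots> \<le> 1 * norm x0 + (norm (F 0) + L * norm \<phi>) / a"
      using \<open>a > 0\<close> \<open>\<tau> \<ge> 0\<close> by (intro add_right_mono mult_right_mono) auto
    finally show ?thesis by simp
  qed
  have "P \<phi> \<in> bcontfun" for \<phi>
    unfolding bcontfun_def bounded_iff using contP boundP by blast
  then have app: "apply_bcontfun (Bcontfun (P \<phi>)) = P \<phi>" for \<phi>
    by (simp add: Bcontfun_inverse)
  have "\<exists>!\<phi>. Bcontfun (P \<phi>) = \<phi>"
  proof (rule banach_fix_type[of "1 / 2"]; (intro allI)?)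
    fix \<phi> \<psi> :: "real \<Rightarrow>\<^sub>C 'a"
    show "dist (Bcontfun (P \<phi>)) (Bcontfun (P \<psi>)) \<le> 1 / 2 * dist \<phi> \<psi>"
    proof (rule dist_bound)
      fix t :: real
      define \<tau> where "\<tau> = max 0 t"
      have "\<tau> \<ge> 0" by (simp add: \<tau>_def)
      have "norm (integral {0..\<tau>} (\<lambda>s. G \<phi> s - G \<psi> s)) \<le> L * dist \<phi> \<psi> / a * exp (a * \<tau>)"
      proof (rule norm_integral_le_exp[OF \<open>a > 0\<close> _ \<open>\<tau> \<ge> 0\<close>])
        show "0 \<le> L * dist \<phi> \<psi>"
          using \<open>L > 0\<close> by simp
        show "continuous_on {0..\<tau>} (\<lambda>s. G \<phi> s - G \<psi> s)"
          by (intro continuous_intros contG)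
        fix s
        have "norm (G \<phi> s - G \<psi> s) \<le> L * norm (exp (a * s) *\<^sub>R (\<phi> s - \<psi> s))"
          unfolding G_def scaleR_diff_right by (rule lip)
        also have "\<dots> \<le> L * (exp (a * s) * dist \<phi> \<psi>)"
          using \<open>L > 0\<close> dist_bounded[of \<phi> s \<psi>] by (simp add: dist_norm)
        finally show "norm (G \<phi> s - G \<psi> s) \<le> L * dist \<phi> \<psi> * exp (a * s)"
          by (simp add: algebra_simps)
      qed
      moreover have "P \<phi> t - P \<psi> t
          = exp (- (a * \<tau>)) *\<^sub>R integral {0..\<tau>} (\<lambda>s. G \<phi> s - G \<psi> s)"
        unfolding P_def \<tau>_def[symmetric]
        by (subst Henstock_Kurzweil_Integration.integral_diff)
           (auto intro: integrable_continuous_real contG simp: algebra_simps)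
      ultimately have "dist (P \<phi> t) (P \<psi> t) \<le> exp (- (a * \<tau>)) * (L * dist \<phi> \<psi> / a * exp (a * \<tau>))"
        unfolding dist_norm by (simp only: norm_scaleR abs_exp_cancel mult_left_mono exp_ge_zero)
      also have "\<dots> = 1 / 2 * dist \<phi> \<psi>"
        using \<open>L > 0\<close> by (simp add: a_def exp_minus field_simps)
      finally show "dist (Bcontfun (P \<phi>) t) (Bcontfun (P \<psi>) t) \<le> 1 / 2 * dist \<phi> \<psi>"
        by (simp add: app)
    qed
  qed auto
  then obtain \<phi> where "Bcontfun (P \<phi>) = \<phi>" by blast
  then have fixpoint: "\<phi> t = P \<phi> t" for t
    using app[of \<phi>] by simp
  define g where "g t = exp (a * t) *\<^sub>R \<phi> t" for t
  have g: "g t = x0 + integral {0..t} (G \<phi>)" if "t \<ge> 0" for t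
    unfolding g_def fixpoint P_def using that by (simp add: exp_minus max_def)
  have "(g has_vector_derivative F (g t)) (at t within {0..})" if "t \<ge> 0" for t
  proof -
    have "((\<lambda>t. x0 + integral {0..t} (G \<phi>)) has_vector_derivative F (g t)) (at t within {0..})"
      using integral_derivative_halfline[OF contG that, of \<phi>]
      by (auto intro!: derivative_eq_intros simp: G_def g_def)
    then show ?thesis
      by (rule has_vector_derivative_transform[rotated 2]) (use that g in auto)
  qed
  moreover have "g 0 = x0" by (simp add: g)
  ultimately show ?thesis
    unfolding global_solution_def by blast
qed

section \<open>A Gronwall inequality for a pointwise maximum\<close>

text \<open>
  The maximum of a family of differentiable functions need not be differentiable, so the derivative
  bound is integrated for each member separately: every member stays below the primitive \<open>U\<close> of
  \<open>\<kappa> f\<close> with \<open>U 0 = f 0\<close>, hence so does the maximum \<open>f\<close>, and then \<open>U' = \<kappa> f \<le> \<kappa> U\<close>.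
\<close>

lemma gronwall_finite_max:
  fixes D D' :: "'i \<Rightarrow> real \<Rightarrow> real"
  assumes "\<kappa> \<ge> 0" and cont: "continuous_on {0..} f"
    and init: "\<And>i. D i 0 \<le> f 0"
    and attained: "\<And>t. t \<ge> 0 \<Longrightarrow> \<exists>i. f t = D i t"
    and der: "\<And>i t. t \<ge> 0 \<Longrightarrow> (D i has_real_derivative D' i t) (at t within {0..})"
    and bound: "\<And>i t. t \<ge> 0 \<Longrightarrow> D' i t \<le> \<kappa> * f t"
    and "t \<ge> 0"
  shows "f t \<le> exp (\<kappa> * t) * f 0"
proof -
  define U where "U t = f 0 + \<kappa> * integral {0..t} f" for t
  have U0: "U 0 = f 0" by (simp add: U_def)
  have derU: "(U has_real_derivative \<kappa> * f t) (at t within {0..})" if "t \<ge> 0" for t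
    using integral_derivative_halfline[OF cont that] unfolding U_def
    by (auto intro!: derivative_eq_intros
          simp: has_real_derivative_iff_has_vector_derivative[symmetric])
  have fU: "f t \<le> U t" if t: "t \<ge> 0" for t
  proof -
    obtain i where i: "f t = D i t" using attained[OF t] by blast
    have "D i t - U t \<le> D i 0 - U 0"
      using bound
      by (intro halfline_nonincreasing[of "\<lambda>t. D i t - U t" "\<lambda>t. D' i t - \<kappa> * f t"] t
            DERIV_diff der derU) auto
    then show ?thesis
      using init[of i] by (simp add: U0 i)
  qed
  have "exp (- \<kappa> * t) * U t \<le> exp (- \<kappa> * 0) * U 0"
  proof (rule halfline_nonincreasing[OF _ _ \<open>t \<ge> 0\<close>])
    fix t :: real assume t: "t \<ge> 0"
    show "((\<lambda>t. exp (- \<kappa> * t) * U t) has_real_derivative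
        exp (- \<kappa> * t) * (\<kappa> * (f t - U t))) (at t within {0..})"
      by (rule derivative_eq_intros derU[OF t] refl | simp)+ (simp add: algebra_simps)
    show "exp (- \<kappa> * t) * (\<kappa> * (f t - U t)) \<le> 0"
      using fU[OF t] \<open>\<kappa> \<ge> 0\<close> by (simp add: mult_le_0_iff)
  qed
  then have "U t \<le> exp (\<kappa> * t) * f 0"
    by (simp add: U0 exp_minus field_simps)
  then show ?thesis
    using fU[OF \<open>t \<ge> 0\<close>] by linarith
qed

section \<open>The oscillation seminorm\<close>

definition osc :: "real ^ 'n \<Rightarrow> real" where
  "osc w = Max (range (\<lambda>(y, z). w $ y - w $ z))"

lemma osc_ge: "w $ y - w $ z \<le> osc w"
  unfolding osc_def by (rule Max_ge) (auto intro: rev_image_eqI[of "(y, z)"])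

lemma osc_attained: "\<exists>y z. osc w = w $ y - w $ z"
proof -
  have "osc w \<in> range (\<lambda>(y, z). w $ y - w $ z)"
    unfolding osc_def by (rule Max_in) auto
  then show ?thesis by auto
qed

lemma osc_le: "(\<And>y z. w $ y - w $ z \<le> c) \<Longrightarrow> osc w \<le> c"
  using osc_attained[of w] by metis

lemma osc_nonneg: "0 \<le> osc w"
  using osc_ge[of w undefined undefined] by simp

lemma osc_le_add: "osc v \<le> osc w + osc (v - w)"
proof (rule osc_le)
  fix y z show "v $ y - v $ z \<le> osc w + osc (v - w)"
    using osc_ge[of w y z] osc_ge[of "v - w" y z] by simp
qed

lemma osc_uminus: "osc (- w) = osc w"
proof -
  have "osc (- w) \<le> osc w" for w :: "real ^ 'a"
    by (rule osc_le) (use osc_ge[of w] in simp)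
  from this[of w] this[of "- w"] show ?thesis by simp
qed

lemma osc_add_const: "osc (w + c *\<^sub>R 1) = osc w"
  by (simp add: osc_def)

lemma osc_le_norm: "osc w \<le> 2 * norm w"
proof (rule osc_le)
  fix y z show "w $ y - w $ z \<le> 2 * norm w"
    using component_le_norm_cart[of w y] component_le_norm_cart[of w z] by linarith
qed

lemma continuous_on_osc: "continuous_on S osc"
proof (rule lipschitz_on_continuous_on[of 2], rule lipschitz_onI)
  fix v w :: "real ^ 'a"
  show "dist (osc v) (osc w) \<le> 2 * dist v w"
    using osc_le_add[of v w] osc_le_add[of w v] osc_le_norm[of "v - w"] osc_le_norm[of "w - v"]
    by (simp add: dist_norm norm_minus_commute)
qed simp

text \<open>
  A function whose mean vanishes is, at each point, the average of its differences to the other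
  values. So \<open>osc\<close>, which only sees functions modulo constants, controls the norm once the constant
  is fixed by the gauge.
\<close>

lemma norm_le_osc:
  assumes "prob_vec \<nu>" "expect \<nu> w = 0"
  shows "norm w \<le> CARD('n) * osc (w :: real ^ 'n)"
proof -
  have "\<bar>w $ y\<bar> \<le> osc w" for y
  proof -
    have eq: "w $ y = (\<Sum>z\<in>UNIV. \<nu> $ z * (w $ y - w $ z))"
      using assms by (simp add: prob_vec_def expect_def right_diff_distrib sum_subtractf
          sum_distrib_right[symmetric])
    have "\<bar>\<Sum>z\<in>UNIV. \<nu> $ z * (w $ y - w $ z)\<bar> \<le> (\<Sum>z\<in>UNIV. \<nu> $ z * osc w)"
    proof (rule order_trans[OF sum_abs], rule sum_mono)
      fix z
      have "\<bar>w $ y - w $ z\<bar> \<le> osc w"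
        using osc_ge[of w y z] osc_ge[of w z y] by linarith
      then show "\<bar>\<nu> $ z * (w $ y - w $ z)\<bar> \<le> \<nu> $ z * osc w"
        using assms(1) by (auto simp: abs_mult prob_vec_def intro!: mult_mono)
    qed
    also have "\<dots> = osc w"
      using assms(1) by (simp add: prob_vec_def sum_distrib_right[symmetric])
    finally show ?thesis
      using eq by simp
  qed
  then have "(\<Sum>y\<in>UNIV. \<bar>w $ y\<bar>) \<le> (\<Sum>y\<in>(UNIV::'n set). osc w)"
    by (intro sum_mono)
  then show ?thesis
    using norm_le_l1_cart[of w] by simp
qed

section \<open>Contraction by log-partition maps\<close>

definition log_partition :: "real ^ 'n ^ 'n \<Rightarrow> real ^ 'n \<Rightarrow> real ^ 'n" where
  "log_partition A u = (\<chi> x. ln (partition_fun A u x))"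

lemma partition_fun_pos:
  assumes "\<And>x y. A $ x $ y > 0"
  shows "partition_fun A u x > 0"
  unfolding partition_fun_def by (rule sum_pos) (use assms in auto)

lemma positive_matrix_row_ratio:
  fixes A :: "real ^ 'n ^ 'n"
  assumes "\<And>x y. A $ x $ y > 0"
  obtains r where "0 < r" "r \<le> 1" "\<And>x x' z. r * A $ x $ z \<le> A $ x' $ z"
proof
  let ?R = "range (\<lambda>(x, x', z). A $ x' $ z / A $ x $ z)"
  define r where "r = Min ?R"
  have "r \<in> ?R"
    unfolding r_def by (rule Min_in) auto
  then show "0 < r" using assms by auto
  have le: "r \<le> A $ x' $ z / A $ x $ z" for x x' z
    unfolding r_def by (rule Min_le) (auto intro: rev_image_eqI[of "(x, x', z)"])
  show "r * A $ x $ z \<le> A $ x' $ z" for x x' z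
    using le[of x' z x] assms[of x z] by (simp add: pos_le_divide_eq)
  show "r \<le> 1"
    using le[of undefined undefined undefined] assms[of undefined undefined] by simp
qed

text \<open>
  A form of the Birkhoff-Hopf theorem for Hilbert's projective metric. The increment of the
  log-partition map from \<open>v\<close> to \<open>u\<close> at \<open>x\<close> is the logarithm of \<open>E x\<close>, the mean of \<open>e\<^bsup>u - v\<^esup>\<close> under
  the tilted law \<open>p x\<close>. Although these laws can be arbitrarily concentrated, the ratio of two rows
  \<open>p x\<close> and \<open>p x'\<close> is bounded in terms of the matrix alone, because the tilt \<open>e\<^bsup>v\<^esup>\<close> cancels. This
  is a Doeblin condition \<open>\<epsilon> p x \<le> p x'\<close> with \<open>\<epsilon>\<close> independent of \<open>v\<close>: the two laws share a mass
  \<open>\<epsilon>\<close>, and only the remaining mass \<open>1 - \<epsilon>\<close> can see the oscillation.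
\<close>

lemma log_partition_contraction:
  fixes A :: "real ^ 'n ^ 'n"
  assumes pos: "\<And>x y. A $ x $ y > 0"
  obtains \<epsilon> where "0 < \<epsilon>" "\<epsilon> \<le> 1"
    "\<And>u v. osc (log_partition A u - log_partition A v) \<le> (1 - \<epsilon>) * osc (u - v)"
proof -
  obtain r where r: "0 < r" "r \<le> 1" and ratio: "\<And>x x' z. r * A $ x $ z \<le> A $ x' $ z"
    using positive_matrix_row_ratio[OF pos] by blast
  define \<epsilon> where "\<epsilon> = r\<^sup>2"
  have \<epsilon>: "0 < \<epsilon>" "\<epsilon> \<le> 1"
    using r by (auto simp: \<epsilon>_def power_le_one)
  have "osc (log_partition A u - log_partition A v) \<le> (1 - \<epsilon>) * osc (u - v)" for u v
  proof (rule osc_le)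
    fix x x'
    define w where "w = u - v"
    define p where "p x z = A $ x $ z * exp (v $ z) / partition_fun A v x" for x z
    define E where "E x = (\<Sum>z\<in>UNIV. p x z * exp (w $ z))" for x
    have Zpos: "partition_fun A q x > 0" for q x
      using partition_fun_pos[OF pos] .
    have p0: "p x z \<ge> 0" for x z
      using pos[of x z] Zpos[of v x] by (simp add: p_def)
    have p1: "(\<Sum>z\<in>UNIV. p x z) = 1" for x
      using Zpos[of v x] by (simp add: p_def sum_divide_distrib[symmetric] partition_fun_def)
    have E: "E x = partition_fun A u x / partition_fun A v x" for x
      by (simp add: E_def p_def w_def partition_fun_def sum_divide_distrib exp_diff)
    then have Epos: "E x > 0" for x
      using Zpos by simp
    \<comment> \<open>One factor \<open>r\<close> is lost in the kernel entry and one in the normalisation.\<close>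
    have doeblin: "\<epsilon> * p x z \<le> p x' z" for z
    proof -
      have Z: "r * partition_fun A v x' \<le> partition_fun A v x"
        unfolding partition_fun_def sum_distrib_left mult.assoc[symmetric]
        by (intro sum_mono mult_right_mono ratio) auto
      have "r * (r * (A $ x $ z * exp (v $ z) * partition_fun A v x'))
          = (r * A $ x $ z) * exp (v $ z) * (r * partition_fun A v x')"
        by (simp add: algebra_simps)
      also have "\<dots> \<le> A $ x' $ z * exp (v $ z) * partition_fun A v x"
        using r pos[of x z] pos[of x' z] Zpos[of v x'] less_imp_le[OF Zpos[of v x]]
        by (intro mult_mono ratio Z) (auto intro!: mult_nonneg_nonneg less_imp_le)
      finally show ?thesis
        using Zpos[of v x] Zpos[of v x']
        by (simp add: p_def \<epsilon>_def power2_eq_square field_simps)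
    qed
    obtain a where a: "\<And>z. w $ a \<le> w $ z"
      using ex_min_if_finite[of "range (($) w)"] by (auto simp: not_less)
    have lower: "\<epsilon> * E x + (1 - \<epsilon>) * exp (w $ a) \<le> E x'"
    proof -
      have "(1 - \<epsilon>) * exp (w $ a) = (\<Sum>z\<in>UNIV. (p x' z - \<epsilon> * p x z) * exp (w $ a))"
        by (simp add: sum_distrib_right[symmetric] sum_subtractf sum_distrib_left[symmetric] p1)
      also have "\<dots> \<le> (\<Sum>z\<in>UNIV. (p x' z - \<epsilon> * p x z) * exp (w $ z))"
        by (intro sum_mono mult_left_mono) (use a doeblin in auto)
      also have "\<dots> = E x' - \<epsilon> * E x"
        by (simp add: E_def left_diff_distrib sum_subtractf sum_distrib_left mult.assoc)
      finally show ?thesis by simp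
    qed
    have upper: "E x \<le> exp (w $ a + osc w)"
    proof -
      have "E x \<le> (\<Sum>z\<in>UNIV. p x z * exp (w $ a + osc w))"
        unfolding E_def
        by (intro sum_mono mult_left_mono p0) (use osc_ge[of w _ a] in \<open>simp add: algebra_simps\<close>)
      then show ?thesis
        by (simp add: sum_distrib_right[symmetric] p1)
    qed
    \<comment> \<open>Convexity of \<open>exp\<close> turns the lower bound on \<open>E x' / E x\<close>, a mixture of 1 and
      \<open>e\<^bsup>- osc w\<^esup>\<close> with weights \<open>\<epsilon>\<close> and \<open>1 - \<epsilon>\<close>, into an exponential.\<close>
    have "exp ((1 - \<epsilon>) * (- osc w)) \<le> \<epsilon> * exp 0 + (1 - \<epsilon>) * exp (- osc w)"
      using convex_onD[OF exp_convex, of "1 - \<epsilon>" 0 "- osc w"] \<epsilon> by simp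
    then have "exp ((1 - \<epsilon>) * (- osc w)) * E x \<le> (\<epsilon> + (1 - \<epsilon>) * exp (- osc w)) * E x"
      by (intro mult_right_mono) (use Epos[of x] in auto)
    also have "\<dots> = \<epsilon> * E x + (1 - \<epsilon>) * (exp (- osc w) * E x)"
      by (simp add: algebra_simps)
    also have "\<dots> \<le> \<epsilon> * E x + (1 - \<epsilon>) * exp (w $ a)"
      using \<epsilon> upper by (intro add_left_mono mult_left_mono) (auto simp: exp_add exp_minus field_simps)
    finally have "exp ((1 - \<epsilon>) * (- osc w)) * E x \<le> E x'"
      using lower by linarith
    then have "ln (exp ((1 - \<epsilon>) * (- osc w)) * E x) \<le> ln (E x')"
      using Epos[of x] by (subst ln_le_cancel_iff) (auto simp: Epos)
    then have "ln (E x) - ln (E x') \<le> (1 - \<epsilon>) * osc w"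
      using Epos[of x] by (simp add: ln_mult)
    moreover have "ln (E x) = log_partition A u $ x - log_partition A v $ x" for x
      using Zpos[of u x] Zpos[of v x] by (simp add: E log_partition_def ln_div)
    ultimately show "(log_partition A u - log_partition A v) $ x
        - (log_partition A u - log_partition A v) $ x' \<le> (1 - \<epsilon>) * osc (u - v)"
      by (simp add: w_def)
  qed
  then show thesis using that \<epsilon> by blast
qed

section \<open>The Sinkhorn flow\<close>

lemma expect_diff: "expect p (f - g) = expect p f - expect p g"
  by (simp add: expect_def right_diff_distrib sum_subtractf)

lemma expect_add: "expect p (f + g) = expect p f + expect p g"
  by (simp add: expect_def distrib_left sum.distrib)

locale positive_bridge =
  fixes K :: "real ^ 'n ^ 'n" and \<mu> \<nu> :: "real ^ 'n"
  assumes K_pos: "\<And>x y. K $ x $ y > 0"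
    and mu_pos: "\<And>x. \<mu> $ x > 0" and nu_pos: "\<And>y. \<nu> $ y > 0"
    and mu_prob: "prob_vec \<mu>" and nu_prob: "prob_vec \<nu>"
begin

abbreviation "m \<equiv> model_marginal K \<mu>"
abbreviation "F \<equiv> flow_field K \<mu> \<nu>"

lemma Z_pos: "partition_fun K g x > 0"
  by (rule partition_fun_pos[OF K_pos])

text \<open>
  Up to normalisation, the kernel of the chain started from \<open>\<mu>\<close> and run backwards.
\<close>

definition K_rev :: "real ^ 'n ^ 'n" where
  "K_rev = (\<chi> y x. \<mu> $ x * K $ x $ y)"

lemma K_rev_pos: "K_rev $ y $ x > 0"
  using K_pos mu_pos by (simp add: K_rev_def)

lemma marginal_log_partition:
  "m g $ y = exp (g $ y) * partition_fun K_rev (- log_partition K g) y"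
proof -
  have "\<mu> $ x * tilted_kernel K g x y
      = exp (g $ y) * (K_rev $ y $ x * exp ((- log_partition K g) $ x))" for x
    using Z_pos[of g x]
    by (simp add: tilted_kernel_def K_rev_def log_partition_def exp_minus divide_inverse mult_ac)
  then show ?thesis
    by (simp add: model_marginal_def partition_fun_def[of K_rev] sum_distrib_left)
qed

lemma marginal_pos: "m g $ y > 0"
  by (simp add: marginal_log_partition partition_fun_pos[OF K_rev_pos])

lemma marginal_sum: "(\<Sum>y\<in>UNIV. m g $ y) = 1"
proof -
  have "(\<Sum>y\<in>UNIV. m g $ y) = (\<Sum>x\<in>UNIV. \<mu> $ x * (\<Sum>y\<in>UNIV. tilted_kernel K g x y))"
    unfolding model_marginal_def by (simp add: sum_distrib_left) (rule sum.swap)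
  also have "\<dots> = (\<Sum>x\<in>UNIV. \<mu> $ x)"
  proof (rule sum.cong[OF refl])
    fix x
    have "(\<Sum>y\<in>UNIV. tilted_kernel K g x y) = 1"
      using Z_pos[of g x]
      by (simp add: tilted_kernel_def sum_divide_distrib[symmetric] partition_fun_def)
    then show "\<mu> $ x * (\<Sum>y\<in>UNIV. tilted_kernel K g x y) = \<mu> $ x"
      by simp
  qed
  finally show ?thesis
    using mu_prob by (simp add: prob_vec_def)
qed

lemma nu_sum: "(\<Sum>y\<in>UNIV. \<nu> $ y) = 1"
  using nu_prob by (simp add: prob_vec_def)

lemma F_component:
  "F g $ y = - ln (m g $ y / \<nu> $ y) + expect \<nu> (log_ratio (m g) \<nu>)"
  by (simp add: flow_field_def log_ratio_def)

lemma expect_F: "expect \<nu> (F g) = 0"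
proof -
  have "expect \<nu> (F g) = - (\<Sum>y\<in>UNIV. \<nu> $ y * ln (m g $ y / \<nu> $ y))
      + (\<Sum>y\<in>UNIV. \<nu> $ y) * expect \<nu> (log_ratio (m g) \<nu>)"
    unfolding expect_def[of _ "F g"] F_component
    by (simp add: right_diff_distrib sum_subtractf sum_distrib_right)
  then show ?thesis
    by (simp add: nu_sum) (simp add: expect_def log_ratio_def)
qed

text \<open>
  A zero of \<open>F\<close> is a \<open>g\<close> for which \<open>log (m\<^sub>g / \<nu>)\<close> is constant; as both vectors have mass 1, that
  constant is 0.
\<close>

lemma F_zero_iff: "F g = 0 \<longleftrightarrow> m g = \<nu>"
proof
  assume "m g = \<nu>"
  moreover have "log_ratio \<nu> \<nu> = 0"
    using nu_pos by (simp add: log_ratio_def vec_eq_iff less_imp_neq[THEN not_sym])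
  ultimately show "F g = 0"
    by (simp add: flow_field_def expect_def)
next
  assume "F g = 0"
  define c where "c = expect \<nu> (log_ratio (m g) \<nu>)"
  have "ln (m g $ y / \<nu> $ y) = c" for y
    using F_component[of g y] \<open>F g = 0\<close> by (simp add: c_def)
  then have "m g $ y / \<nu> $ y = exp c" for y
    using exp_ln[of "m g $ y / \<nu> $ y"] marginal_pos[of g y] nu_pos[of y] by simp
  then have eq: "m g $ y = exp c * \<nu> $ y" for y
    using nu_pos[of y] by (simp add: divide_eq_eq)
  have "(\<Sum>y\<in>UNIV. m g $ y) = exp c * (\<Sum>y\<in>UNIV. \<nu> $ y)"
    by (simp only: eq sum_distrib_left)
  then have "exp c = 1"
    by (simp only: marginal_sum nu_sum mult_1_right)
  then show "m g = \<nu>"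
    by (simp add: vec_eq_iff eq)
qed

text \<open>
  An Euler step of length 1 is one round of Sinkhorn's algorithm: each of its two half steps is a
  log-partition map up to sign. The factor of the forward half step already suffices, so the backward
  one only has to be nonexpansive.
\<close>

lemma sinkhorn_step_contraction:
  obtains \<kappa> where "0 \<le> \<kappa>" "\<kappa> < 1"
    "\<And>g h. osc ((g + F g) - (h + F h)) \<le> \<kappa> * osc (g - h)"
proof -
  obtain \<epsilon> where \<epsilon>: "0 < \<epsilon>" "\<epsilon> \<le> 1"
    and L: "\<And>u v. osc (log_partition K u - log_partition K v) \<le> (1 - \<epsilon>) * osc (u - v)"
    using log_partition_contraction[of K, OF K_pos] by blast
  obtain \<delta> where \<delta>: "0 < \<delta>" "\<delta> \<le> 1"
    and L': "\<And>u v. osc (log_partition K_rev u - log_partition K_rev v) \<le> (1 - \<delta>) * osc (u - v)"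
    using log_partition_contraction[of K_rev, OF K_rev_pos] by blast
  define \<psi> where "\<psi> g = log_partition K_rev (- log_partition K g)" for g
  define c where "c g = expect \<nu> (log_ratio (m g) \<nu>)" for g
  have step: "(g + F g) $ y = ln (\<nu> $ y) - \<psi> g $ y + c g" for g y
  proof -
    have "ln (m g $ y / \<nu> $ y) = ln (m g $ y) - ln (\<nu> $ y)"
      using marginal_pos[of g y] nu_pos[of y] by (simp add: ln_div)
    moreover have "ln (m g $ y) = g $ y + \<psi> g $ y"
      using partition_fun_pos[OF K_rev_pos, of "- log_partition K g" y]
      by (simp add: marginal_log_partition \<psi>_def log_partition_def[of K_rev] ln_mult)
    ultimately show ?thesis
      by (simp add: F_component c_def)
  qed
  show thesis
  proof
    show "0 \<le> 1 - \<epsilon>" "1 - \<epsilon> < 1" using \<epsilon> by auto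
    fix g h
    have "(g + F g) - (h + F h) = - (\<psi> g - \<psi> h) + (c g - c h) *\<^sub>R 1"
    proof (rule vec_eq_iff[THEN iffD2], rule allI)
      fix y
      show "((g + F g) - (h + F h)) $ y = (- (\<psi> g - \<psi> h) + (c g - c h) *\<^sub>R 1) $ y"
        unfolding vector_minus_component step by simp
    qed
    then have "osc ((g + F g) - (h + F h)) = osc (\<psi> g - \<psi> h)"
      by (simp only: osc_add_const osc_uminus)
    also have "\<dots> \<le> (1 - \<delta>) * osc (- log_partition K g - - log_partition K h)"
      unfolding \<psi>_def by (rule L')
    also have "\<dots> \<le> osc (- log_partition K g - - log_partition K h)"
      using \<delta> mult_right_mono[OF _ osc_nonneg, of "1 - \<delta>" 1] by simp
    also have "\<dots> = osc (log_partition K g - log_partition K h)"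
      using osc_uminus[of "log_partition K g - log_partition K h"] by simp
    also have "\<dots> \<le> (1 - \<epsilon>) * osc (g - h)"
      by (rule L)
    finally show "osc ((g + F g) - (h + F h)) \<le> (1 - \<epsilon>) * osc (g - h)" .
  qed
qed

text \<open>
  \<open>F\<close> is the difference of two maps that do not increase \<open>osc\<close>, namely \<open>g \<mapsto> g + F g\<close> and the
  identity; the gauge then converts \<open>osc\<close> into the norm.
\<close>

lemma F_lipschitz: "norm (F g - F h) \<le> 4 * CARD('n) * norm (g - h)"
proof -
  obtain \<kappa> where \<kappa>: "0 \<le> \<kappa>" "\<kappa> < 1"
    and step: "\<And>g h. osc ((g + F g) - (h + F h)) \<le> \<kappa> * osc (g - h)"
    using sinkhorn_step_contraction by blast
  have "osc (F g - F h) \<le> osc ((g + F g) - (h + F h)) + osc ((F g - F h) - ((g + F g) - (h + F h)))"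
    by (rule osc_le_add)
  also have "(F g - F h) - ((g + F g) - (h + F h)) = - (g - h)"
    by simp
  also have "osc ((g + F g) - (h + F h)) + osc (- (g - h)) \<le> 1 * osc (g - h) + osc (g - h)"
    using order_trans[OF step[of g h] mult_right_mono[OF less_imp_le[OF \<kappa>(2)] osc_nonneg]]
    unfolding osc_uminus by simp
  also have "\<dots> \<le> 4 * norm (g - h)"
    using osc_le_norm[of "g - h"] by simp
  finally have "CARD('n) * osc (F g - F h) \<le> CARD('n) * (4 * norm (g - h))"
    by (intro mult_left_mono) auto
  moreover have "norm (F g - F h) \<le> CARD('n) * osc (F g - F h)"
    by (rule norm_le_osc[OF nu_prob]) (simp add: expect_diff expect_F)
  ultimately show ?thesis
    by (simp only: mult.left_commute mult.assoc)
qed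

lemma F_continuous: "isCont F g"
proof -
  have "(4 * CARD('n))-lipschitz_on UNIV F"
    by (rule lipschitz_onI) (use F_lipschitz in \<open>auto simp: dist_norm\<close>)
  then show ?thesis
    using lipschitz_on_continuous_on continuous_on_eq_continuous_at open_UNIV by blast
qed

lemma solution_component_derivative:
  assumes "global_solution F g0 g" "t \<ge> 0"
  shows "((\<lambda>s. g s $ y) has_real_derivative F (g t) $ y) (at t within {0..})"
  using assms bounded_linear.has_vector_derivative[OF bounded_linear_vec_nth, of g "F (g t)" _ y]
  by (simp add: global_solution_def has_real_derivative_iff_has_vector_derivative)

lemma solution_stays_in_gauge:
  assumes sol: "global_solution F g0 g" and "g0 \<in> gauge_space \<nu>" "t \<ge> 0"
  shows "g t \<in> gauge_space \<nu>"
proof -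
  have "((\<lambda>s. expect \<nu> (g s)) has_real_derivative 0) (at t within {0..})" if "t \<ge> 0" for t
  proof -
    have "((\<lambda>s. expect \<nu> (g s)) has_real_derivative expect \<nu> (F (g t))) (at t within {0..})"
      unfolding expect_def
      by (intro DERIV_sum DERIV_cmult solution_component_derivative[OF sol that])
    then show ?thesis by (simp add: expect_F)
  qed
  then have "expect \<nu> (g t) = expect \<nu> (g 0)"
    using \<open>t \<ge> 0\<close> by (rule halfline_constant)
  then show ?thesis
    using assms by (simp add: gauge_space_def global_solution_def)
qed

text \<open>
  The difference \<open>w\<close> of two solutions has \<open>w' = S - w\<close>, where \<open>S\<close> is the difference of their Sinkhorn
  steps. The factor \<open>e\<^sup>t\<close> absorbs the linear part, which leaves derivative \<open>e\<^sup>t S\<close> with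
  \<open>osc S \<le> \<kappa> osc w\<close>. Gronwall is applied to the finitely many differences of components of \<open>e\<^sup>t w\<close>,
  whose maximum is \<open>e\<^sup>t osc w\<close>.
\<close>

lemma solutions_contract:
  obtains \<gamma> where "\<gamma> > 0"
    "\<And>g0 h0 g h t. global_solution F g0 g \<Longrightarrow> global_solution F h0 h \<Longrightarrow> t \<ge> 0 \<Longrightarrow>
       osc (g t - h t) \<le> exp (- \<gamma> * t) * osc (g0 - h0)"
proof -
  obtain \<kappa> where \<kappa>: "0 \<le> \<kappa>" "\<kappa> < 1"
    and step: "\<And>g h. osc ((g + F g) - (h + F h)) \<le> \<kappa> * osc (g - h)"
    using sinkhorn_step_contraction by blast
  have "osc (g t - h t) \<le> exp (- (1 - \<kappa>) * t) * osc (g0 - h0)"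
    if g: "global_solution F g0 g" and h: "global_solution F h0 h" and t: "t \<ge> 0" for g0 h0 g h t
  proof -
    define f where "f t = exp t * osc (g t - h t)" for t
    define D where "D = (\<lambda>(y, z) t. exp t * ((g t - h t) $ y - (g t - h t) $ z))"
    define S where "S t = (g t + F (g t)) - (h t + F (h t))" for t
    define D' where "D' = (\<lambda>(y, z) t. exp t * (S t $ y - S t $ z))"
    have init: "g 0 = g0" "h 0 = h0"
      using g h by (auto simp: global_solution_def)
    have "f t \<le> exp (\<kappa> * t) * f 0"
    proof (rule gronwall_finite_max[of \<kappa> f D D'])
      have "continuous_on {0..} q" if "global_solution F q0 q" for q0 q
        using that by (auto simp: global_solution_def continuous_on_eq_continuous_within
            intro: has_vector_derivative_continuous)
      from this[OF g] this[OF h] show "continuous_on {0..} f"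
        unfolding f_def
        by (intro continuous_intros continuous_on_compose2[OF continuous_on_osc[of UNIV]]) auto
      show "D i 0 \<le> f 0" for i
        using osc_ge[of "g 0 - h 0"] by (cases i) (simp add: D_def f_def)
      show "\<exists>i. f t = D i t" for t
        using osc_attained[of "g t - h t"] by (auto simp: D_def f_def)
      show "(D i has_real_derivative D' i t) (at t within {0..})" if "t \<ge> 0" for i t
        using solution_component_derivative[OF g that] solution_component_derivative[OF h that]
        by (cases i) (auto simp: D_def D'_def S_def algebra_simps intro!: derivative_eq_intros)
      show "D' i t \<le> \<kappa> * f t" for i t
        using order_trans[OF osc_ge step[of "g t" "h t"]]
        by (cases i) (simp add: D'_def f_def S_def)
    qed (use \<kappa> t in auto)
    then show ?thesis
      by (simp add: f_def init exp_diff exp_minus field_simps)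
  qed
  then show thesis
    using that[of "1 - \<kappa>"] \<kappa> by simp
qed

lemma solution_exists: "\<exists>g. global_solution F g0 g"
  by (rule lipschitz_field_global_solution[of "4 * CARD('n)"]) (use F_lipschitz in auto)

lemma gauge_eqI:
  assumes "g \<in> gauge_space \<nu>" "h \<in> gauge_space \<nu>" "osc (g - h) \<le> 0"
  shows "g = h"
proof -
  have "norm (g - h) \<le> CARD('n) * osc (g - h)"
    using assms by (intro norm_le_osc[OF nu_prob]) (simp add: gauge_space_def expect_diff)
  also have "\<dots> \<le> 0"
    using assms(3) by (simp add: mult_nonneg_nonpos)
  finally show ?thesis by simp
qed

lemma solution_unique:
  assumes "g0 \<in> gauge_space \<nu>" "global_solution F g0 g" "global_solution F g0 h" "t \<ge> 0"
  shows "h t = g t"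
proof (rule gauge_eqI)
  obtain \<gamma> where "osc (h t - g t) \<le> exp (- \<gamma> * t) * osc (g0 - g0)"
    using solutions_contract assms by metis
  then show "osc (h t - g t) \<le> 0"
    by (simp add: osc_def)
qed (use assms solution_stays_in_gauge in auto)

lemma equilibrium_unique:
  assumes "g \<in> gauge_space \<nu>" "h \<in> gauge_space \<nu>" "m g = \<nu>" "m h = \<nu>"
  shows "g = h"
proof (rule gauge_eqI[OF assms(1,2)])
  obtain \<kappa> where \<kappa>: "\<kappa> < 1" and "osc ((g + F g) - (h + F h)) \<le> \<kappa> * osc (g - h)"
    using sinkhorn_step_contraction by metis
  then have "(1 - \<kappa>) * osc (g - h) \<le> 0"
    using assms(3,4) by (simp add: F_zero_iff[symmetric] algebra_simps)
  then show "osc (g - h) \<le> 0"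
    using \<kappa> by (simp add: mult_le_0_iff)
qed

text \<open>
  The proof is Banach's fixed-point argument for the Sinkhorn iteration. The space is complete for
  the norm and the contraction is in \<open>osc\<close>; since the increments \<open>F (x n)\<close> have mean zero, their
  geometric decay in \<open>osc\<close> is a geometric decay in norm, so the iterates form a convergent series.
\<close>

lemma equilibrium_exists: "\<exists>g\<in>gauge_space \<nu>. m g = \<nu>"
proof -
  obtain \<kappa> where \<kappa>: "0 \<le> \<kappa>" "\<kappa> < 1"
    and step: "\<And>g h. osc ((g + F g) - (h + F h)) \<le> \<kappa> * osc (g - h)"
    using sinkhorn_step_contraction by blast
  define x where "x n = ((\<lambda>g. g + F g) ^^ n) 0" for n
  have x0: "x 0 = 0" and xSuc: "x (Suc n) = x n + F (x n)" for n
    by (auto simp: x_def)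
  have decay: "osc (F (x n)) \<le> \<kappa> ^ n * osc (F (x 0))" for n
  proof (induction n)
    case (Suc n)
    have "osc (F (x (Suc n))) \<le> \<kappa> * osc (F (x n))"
      using step[of "x (Suc n)" "x n"] by (simp add: xSuc)
    also have "\<dots> \<le> \<kappa> * (\<kappa> ^ n * osc (F (x 0)))"
      using Suc \<kappa> by (intro mult_left_mono)
    finally show ?case by (simp add: mult.assoc)
  qed simp
  have bound: "norm (F (x n)) \<le> CARD('n) * osc (F (x 0)) * \<kappa> ^ n" for n
  proof -
    have "norm (F (x n)) \<le> CARD('n) * osc (F (x n))"
      by (rule norm_le_osc[OF nu_prob expect_F])
    also have "\<dots> \<le> CARD('n) * (\<kappa> ^ n * osc (F (x 0)))"
      by (intro mult_left_mono decay) simp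
    finally show ?thesis by (simp only: mult_ac)
  qed
  have sum: "summable (\<lambda>n. F (x n))"
    by (rule summable_comparison_test'[of "\<lambda>n. CARD('n) * osc (F (x 0)) * \<kappa> ^ n"])
       (use \<kappa> bound in \<open>auto intro!: summable_mult summable_geometric\<close>)
  have x_sum: "x n = (\<Sum>i<n. F (x i))" for n
    by (induction n) (auto simp: x0 xSuc)
  define l where "l = (\<Sum>n. F (x n))"
  have lim: "x \<longlonglongrightarrow> l"
    using summable_LIMSEQ[OF sum] unfolding l_def by (simp add: x_sum[symmetric])
  have "F l = 0"
    using LIMSEQ_unique[OF isCont_tendsto_compose[OF F_continuous lim] summable_LIMSEQ_zero[OF sum]] .
  have "expect \<nu> (x n) = 0" for n
    by (induction n) (simp_all add: x0 xSuc expect_add expect_F, simp add: expect_def)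
  moreover have "(\<lambda>n. expect \<nu> (x n)) \<longlonglongrightarrow> expect \<nu> l"
    unfolding expect_def by (intro tendsto_intros lim)
  ultimately have "expect \<nu> l = 0"
    by (simp add: LIMSEQ_const_iff)
  with \<open>F l = 0\<close> show ?thesis
    by (auto simp: gauge_space_def F_zero_iff)
qed

lemma solution_converges:
  assumes "g0 \<in> gauge_space \<nu>" and g: "global_solution F g0 g"
    and "h \<in> gauge_space \<nu>" "m h = \<nu>"
  shows "(g \<longlongrightarrow> h) at_top"
proof -
  obtain \<gamma> where "\<gamma> > 0" and contract:
    "\<And>g0 h0 g h t. global_solution F g0 g \<Longrightarrow> global_solution F h0 h \<Longrightarrow> t \<ge> 0 \<Longrightarrow>
       osc (g t - h t) \<le> exp (- \<gamma> * t) * osc (g0 - h0)"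
    using solutions_contract by blast
  have h: "global_solution F h (\<lambda>_. h)"
    using assms(4) by (simp add: global_solution_def F_zero_iff[symmetric])
  have bound: "norm (g t - h) \<le> CARD('n) * (exp (- \<gamma> * t) * osc (g0 - h))" if "t \<ge> 0" for t
  proof -
    have "norm (g t - h) \<le> CARD('n) * osc (g t - h)"
      using solution_stays_in_gauge[OF g assms(1) that] assms(3)
      by (intro norm_le_osc[OF nu_prob]) (simp add: gauge_space_def expect_diff)
    also have "\<dots> \<le> CARD('n) * (exp (- \<gamma> * t) * osc (g0 - h))"
      using contract[OF g h that] by (intro mult_left_mono) auto
    finally show ?thesis .
  qed
  have "((\<lambda>t. g t - h) \<longlongrightarrow> 0) at_top"
  proof (rule Lim_null_comparison)
    show "\<forall>\<^sub>F t in at_top. norm (g t - h) \<le> CARD('n) * (exp (- \<gamma> * t) * osc (g0 - h))"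
      using eventually_ge_at_top[of 0] by eventually_elim (rule bound)
    have "((\<lambda>t. exp (- \<gamma> * t)) \<longlongrightarrow> 0) at_top"
      using \<open>\<gamma> > 0\<close>
      by (intro filterlim_compose[OF exp_at_bot] filterlim_tendsto_neg_mult_at_bot[OF tendsto_const])
         (auto intro: filterlim_ident)
    then show "((\<lambda>t. CARD('n) * (exp (- \<gamma> * t) * osc (g0 - h))) \<longlongrightarrow> 0) at_top"
      by (intro tendsto_mult_right_zero tendsto_mult_left_zero)
  qed
  then show ?thesis
    by (simp add: LIM_zero_iff)
qed

lemma marginal_tendsto:
  assumes "(g \<longlongrightarrow> h) A"
  shows "((\<lambda>t. m (g t)) \<longlongrightarrow> m h) A"
  using Z_pos[of h]
  by (intro vec_tendstoI)
     (auto simp: model_marginal_def tilted_kernel_def partition_fun_def less_imp_neq[THEN not_sym]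
       intro!: tendsto_intros assms)

lemma KL_symmetrized:
  "KL (m g) \<nu> + KL \<nu> (m g) = (\<Sum>y\<in>UNIV. (m g $ y - \<nu> $ y) * ln (m g $ y / \<nu> $ y))"
proof -
  have "ln (\<nu> $ y / m g $ y) = - ln (m g $ y / \<nu> $ y)" for y
    using marginal_pos[of g y] nu_pos[of y] by (simp add: ln_div)
  then show ?thesis
    by (simp add: KL_def left_diff_distrib sum_subtractf sum_negf)
qed

lemma KL_symmetrized_nonneg: "KL (m g) \<nu> + KL \<nu> (m g) \<ge> 0"
  unfolding KL_symmetrized
proof (rule sum_nonneg)
  fix y
  have "ln (m g $ y / \<nu> $ y) = ln (m g $ y) - ln (\<nu> $ y)"
    using marginal_pos[of g y] nu_pos[of y] by (simp add: ln_div)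
  then show "0 \<le> (m g $ y - \<nu> $ y) * ln (m g $ y / \<nu> $ y)"
    using marginal_pos[of g y] nu_pos[of y]
    by (cases "m g $ y \<le> \<nu> $ y") (auto simp: mult_nonneg_nonneg mult_nonpos_nonpos)
qed

text \<open>
  The derivative of \<open>\<J>\<close> along a solution is the pairing of \<open>m\<^sub>g - \<nu>\<close> with \<open>F g\<close>. The constant part
  of \<open>F g\<close> drops out because \<open>m\<^sub>g\<close> and \<open>\<nu>\<close> have the same mass.
\<close>

lemma dissipation:
  assumes sol: "global_solution F g0 g" and "t \<ge> 0"
  shows "((\<lambda>s. dual_objective K \<mu> \<nu> (g s)) has_real_derivative
      - KL (m (g t)) \<nu> - KL \<nu> (m (g t))) (at t within {0..})"
proof -
  note comp = solution_component_derivative[OF sol \<open>t \<ge> 0\<close>]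
  let ?F = "F (g t)" and ?m = "m (g t)"
  define dZ where "dZ x = (\<Sum>z\<in>UNIV. K $ x $ z * (exp (g t $ z) * ?F $ z))" for x
  have Z: "((\<lambda>s. partition_fun K (g s) x) has_real_derivative dZ x) (at t within {0..})" for x
    unfolding partition_fun_def dZ_def
    by (intro DERIV_sum DERIV_cmult) (auto intro!: derivative_eq_intros comp)
  have "((\<lambda>s. dual_objective K \<mu> \<nu> (g s)) has_real_derivative
      (\<Sum>x\<in>UNIV. \<mu> $ x * (dZ x / partition_fun K (g t) x)) - expect \<nu> ?F) (at t within {0..})"
    unfolding dual_objective_def expect_def
    by (intro DERIV_diff DERIV_sum DERIV_cmult comp)
       (use Z_pos Z in \<open>auto intro!: derivative_eq_intros\<close>)
  also have "(\<Sum>x\<in>UNIV. \<mu> $ x * (dZ x / partition_fun K (g t) x))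
      = (\<Sum>x\<in>UNIV. \<Sum>y\<in>UNIV. \<mu> $ x * tilted_kernel K (g t) x y * ?F $ y)"
    by (simp add: dZ_def tilted_kernel_def sum_distrib_left sum_divide_distrib mult_ac)
  also have "\<dots> = (\<Sum>y\<in>UNIV. ?m $ y * ?F $ y)"
    by (subst sum.swap) (simp add: model_marginal_def sum_distrib_right)
  also have "\<dots> - expect \<nu> ?F = (\<Sum>y\<in>UNIV. (?m $ y - \<nu> $ y) * ?F $ y)"
    by (simp add: expect_def left_diff_distrib sum_subtractf)
  also have "\<dots> = - (KL ?m \<nu> + KL \<nu> ?m)"
  proof -
    define c where "c = expect \<nu> (log_ratio ?m \<nu>)"
    have F: "?F $ y = - ln (?m $ y / \<nu> $ y) + c" for y
      by (simp add: F_component c_def)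
    have "(\<Sum>y\<in>UNIV. (?m $ y - \<nu> $ y) * c) = 0"
      by (simp add: sum_distrib_right[symmetric] sum_subtractf marginal_sum nu_sum)
    then show ?thesis
      by (simp add: F KL_symmetrized right_diff_distrib sum_subtractf)
  qed
  finally show ?thesis by simp
qed

end

theorem theorem3p1:
  fixes Q K :: "real ^ 'n ^ 'n" and \<mu> \<nu> :: "real ^ 'n"
  assumes "generator Q" and "K = mat_exp Q"
    and "prob_vec \<mu>" and "prob_vec \<nu>"
    and "\<And>x y. K $ x $ y > 0" and "\<And>x. \<mu> $ x > 0" and "\<And>y. \<nu> $ y > 0"
  shows "(\<forall>g0\<in>gauge_space \<nu>.
            \<exists>g. global_solution (flow_field K \<mu> \<nu>) g0 g
              \<and> (\<forall>t\<ge>0. g t \<in> gauge_space \<nu>)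
              \<and> (\<forall>h. global_solution (flow_field K \<mu> \<nu>) g0 h \<longrightarrow> (\<forall>t\<ge>0. h t = g t)))
       \<and> (\<forall>g0\<in>gauge_space \<nu>. \<forall>g. global_solution (flow_field K \<mu> \<nu>) g0 g \<longrightarrow>
            (\<forall>t\<ge>0.
               ((\<lambda>s. dual_objective K \<mu> \<nu> (g s)) has_real_derivative
                  - KL (model_marginal K \<mu> (g t)) \<nu> - KL \<nu> (model_marginal K \<mu> (g t)))
                 (at t within {0..})
             \<and> - KL (model_marginal K \<mu> (g t)) \<nu> - KL \<nu> (model_marginal K \<mu> (g t)) \<le> 0))
       \<and> (\<exists>!gstar. gstar \<in> gauge_space \<nu> \<and> model_marginal K \<mu> gstar = \<nu>)
       \<and> (\<forall>gstar\<in>gauge_space \<nu>. model_marginal K \<mu> gstar = \<nu> \<longrightarrow>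
            (\<forall>g0\<in>gauge_space \<nu>. \<forall>g. global_solution (flow_field K \<mu> \<nu>) g0 g \<longrightarrow>
               (g \<longlongrightarrow> gstar) at_top
             \<and> ((\<lambda>t. model_marginal K \<mu> (g t)) \<longlongrightarrow> \<nu>) at_top))"
proof -
  interpret positive_bridge K \<mu> \<nu>
    using assms by unfold_locales auto
  show ?thesis
  proof (intro conjI ballI allI impI)
    fix g0 assume g0: "g0 \<in> gauge_space \<nu>"
    obtain g where "global_solution F g0 g"
      using solution_exists by blast
    then show "\<exists>g. global_solution F g0 g \<and> (\<forall>t\<ge>0. g t \<in> gauge_space \<nu>)
        \<and> (\<forall>h. global_solution F g0 h \<longrightarrow> (\<forall>t\<ge>0. h t = g t))"
      using solution_stays_in_gauge[OF _ g0] solution_unique[OF g0] by blast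
  next
    fix g0 g t assume "global_solution F g0 g" "0 \<le> (t::real)"
    then show "((\<lambda>s. dual_objective K \<mu> \<nu> (g s)) has_real_derivative
        - KL (m (g t)) \<nu> - KL \<nu> (m (g t))) (at t within {0..})"
      by (rule dissipation)
    show "- KL (m (g t)) \<nu> - KL \<nu> (m (g t)) \<le> 0"
      using KL_symmetrized_nonneg[of "g t"] by linarith
  next
    show "\<exists>!gstar. gstar \<in> gauge_space \<nu> \<and> m gstar = \<nu>"
      using equilibrium_exists equilibrium_unique by blast
  next
    fix gstar g0 g
    assume star: "gstar \<in> gauge_space \<nu>" "m gstar = \<nu>"
      and g: "g0 \<in> gauge_space \<nu>" "global_solution F g0 g"
    show lim: "(g \<longlongrightarrow> gstar) at_top"
      by (rule solution_converges[OF g star])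
    show "((\<lambda>t. m (g t)) \<longlongrightarrow> \<nu>) at_top"
      using marginal_tendsto[OF lim] star(2) by simp
  qed
qed

end
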